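(* Let $M\ge 1$, let $S\in\mathbb{R}^{M\times M}$ be a constant skew-symmetric matrix, $S^{T}=-S$, and consider the linear matrix differential equation $\dot Q=SQ$ with $Q(t_0)^{T}Q(t_0)=I$. Let an $s$-stage Runge-Kutta method have real coefficients $A=(a_{ij})\in\mathbb{R}^{s\times s}$, $b=(b_1,\dots,b_s)^{T}\in\mathbb{R}^{s}$ satisfying the symplectic condition $$BA+A^{T}B-bb^{T}=0,\qquad B=\operatorname{diag}(b).$$ Let $Q_0=Q(t_0)$ and let $Q_k\in\mathbb{R}^{M\times M}$, $k=0,1,2,\dots$, be a numerical solution obtained by applying this method with time step $\Delta t\in\mathbb{R}$; that is, for each $k$ there are stages $Y_1,\dots,Y_s\in\mathbb{R}^{M\times M}$ (depending on $k$) with $$Y_i=Q_k+\Delta t\sum_{j=1}^{s}a_{ij}SY_j\quad(1\le i\le s),\qquad Q_{k+1}=Q_k+\Delta t\sum_{i=1}^{s}b_iSY_i .$$ Then for all $k\ge 0$ $$Q_{k+1}^{T}Q_{k+1}=Q_k^{T}Q_k=Q(t_0)^{T}Q(t_0)=I,$$ and consequently the discrete generalized energy is conserved: $\operatorname{trace}\left(Q_{k+1}^{T}Q_{k+1}\right)=\operatorname{trace}\left(Q_k^{T}Q_k\right)$.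
   Context: $\operatorname{diag}(b)$ denotes the diagonal matrix with diagonal entries $b_1,\dots,b_s$. The discrete generalized energy of $Q_k$ is $\operatorname{trace}(Q_k^{T}Q_k)$. *)

theory Defs
  imports "HOL-Analysis.Analysis"
begin

definition diag :: "real ^ 's \<Rightarrow> real ^ 's ^ 's"
  where "diag b = (\<chi> i j. if i = j then b $ i else 0)"

text \<open>Column and row vectors are matrices with an index of the one-element type \<^typ>\<open>1\<close>,
  so the product below is the outer product \<open>b b\<^sup>T\<close>.\<close>

definition symplectic_RK :: "real ^ 's ^ 's \<Rightarrow> real ^ 's \<Rightarrow> bool"
  where "symplectic_RK A b \<longleftrightarrow>
    diag b ** A + transpose A ** diag b
      - (columnvector b :: real ^ 1 ^ 's) ** (rowvector b :: real ^ 's ^ 1) = 0"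

text \<open>One step of size \<open>h\<close> for the autonomous equation \<open>x' = f x\<close>. It is a relation because the
  method may be implicit: the stage equations need not have a solution, or a unique one.\<close>

definition RK_step ::
  "real ^ 's ^ 's \<Rightarrow> real ^ 's \<Rightarrow> ('v::real_vector \<Rightarrow> 'v) \<Rightarrow> real \<Rightarrow> 'v \<Rightarrow> 'v \<Rightarrow> bool"
  where "RK_step A b f h x x' \<longleftrightarrow>
    (\<exists>Y :: 's \<Rightarrow> 'v.
      (\<forall>i. Y i = x + h *\<^sub>R (\<Sum>j\<in>UNIV. A $ i $ j *\<^sub>R f (Y j))) \<and>
      x' = x + h *\<^sub>R (\<Sum>i\<in>UNIV. b $ i *\<^sub>R f (Y i)))"

definition discrete_energy :: "real ^ 'm ^ 'm \<Rightarrow> real"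
  where "discrete_energy Q = trace (transpose Q ** Q)"

end

theory Submission
  imports Defs
begin

text \<open>The orthogonality defect is the quadratic function \<open>p X X\<close> with the bilinear form
  \<open>p X Y = X\<^sup>T Y\<close>, and it is a first integral of \<open>Q' = S Q\<close>: skew-symmetry gives
  \<open>p X (S X) + p (S X) X = X\<^sup>T (S + S\<^sup>T) X = 0\<close> for every matrix \<open>X\<close>. Symplectic Runge-Kutta
  methods preserve every quadratic first integral (Cooper's theorem). Writing \<open>K i\<close> for the
  vector field at stage \<open>i\<close>, expand \<open>p\<close> at the new point by bilinearity. In the
  terms linear in the step size, replace the old point by \<open>Y i - h (\<Sum>j. a i j K j)\<close>. Each
  stage value \<open>Y i\<close> then contributes nothing because \<open>p\<close> is a first integral. What remains is
  \<open>h\<^sup>2\<close> times the double sum of \<open>(b i b j - b i a i j - b j a j i) p (K i) (K j)\<close>, whose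
  coefficients are the entries of the symplecticity matrix up to sign. The time steps are then
  chained by induction, starting from the orthogonal initial value.\<close>

lemma symplectic_RK_entries:
  assumes "symplectic_RK A b"
  shows "b $ i * b $ j = b $ i * A $ i $ j + b $ j * A $ j $ i"
proof -
  have "(diag b ** A) $ i $ j = b $ i * A $ i $ j"
    by (simp add: matrix_matrix_mult_def diag_def if_distrib[of "\<lambda>x. x * _"] cong: if_cong)
  moreover have "(transpose A ** diag b) $ i $ j = A $ j $ i * b $ j"
    by (simp add: matrix_matrix_mult_def diag_def transpose_def if_distrib[of "\<lambda>x. _ * x"]
        cong: if_cong)
  moreover have "((columnvector b :: real ^ 1 ^ _) ** (rowvector b :: real ^ _ ^ 1)) $ i $ j
      = b $ i * b $ j"
    by (simp add: matrix_matrix_mult_def columnvector_def rowvector_def)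
  moreover have "(diag b ** A + transpose A ** diag b
      - (columnvector b :: real ^ 1 ^ _) ** (rowvector b :: real ^ _ ^ 1)) $ i $ j = 0"
    using assms by (simp add: symplectic_RK_def)
  ultimately show ?thesis
    by (simp add: algebra_simps)
qed

text \<open>Cooper's theorem. The order of the arguments of \<open>p\<close> is kept throughout, and its values
  lie in an arbitrary vector space; thus the matrix-valued invariant \<open>X\<^sup>T X\<close>, whose form
  \<open>X\<^sup>T Y\<close> is not symmetric, is covered at once instead of entry by entry.\<close>

lemma symplectic_RK_preserves_quadratic_invariant:
  fixes p :: "'v::real_vector \<Rightarrow> 'v \<Rightarrow> 'w::real_vector"
  assumes p: "bilinear p"
    and invariant: "\<And>x. p x (f x) + p (f x) x = 0"
    and sympl: "symplectic_RK A b"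
    and step: "RK_step A b f h x x'"
  shows "p x' x' = p x x"
proof -
  obtain Y where Y: "\<And>i. Y i = x + h *\<^sub>R (\<Sum>j\<in>UNIV. A $ i $ j *\<^sub>R f (Y j))"
    and x': "x' = x + h *\<^sub>R (\<Sum>i\<in>UNIV. b $ i *\<^sub>R f (Y i))"
    using step unfolding RK_step_def by blast
  define K where "K i = f (Y i)" for i
  have sum_left: "p (\<Sum>i\<in>UNIV. c i *\<^sub>R K i) y = (\<Sum>i\<in>UNIV. c i *\<^sub>R p (K i) y)"
    and sum_right: "p y (\<Sum>i\<in>UNIV. c i *\<^sub>R K i) = (\<Sum>i\<in>UNIV. c i *\<^sub>R p y (K i))" for c y
    using p linear_sum[of "\<lambda>x. p x y" "\<lambda>i. c i *\<^sub>R K i" UNIV]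
    by (simp_all add: bilinear_def linear_sum bilinear_lmul[OF p] bilinear_rmul[OF p])
  note expand = bilinear_ladd[OF p] bilinear_radd[OF p] bilinear_lmul[OF p] bilinear_rmul[OF p]
    sum_left sum_right

  have stage: "p x (K i) + p (K i) x
      = - (h *\<^sub>R (\<Sum>j\<in>UNIV. A $ i $ j *\<^sub>R (p (K i) (K j) + p (K j) (K i))))" for i
  proof -
    have "0 = p (Y i) (K i) + p (K i) (Y i)"
      by (simp add: K_def invariant)
    also have "\<dots> = p (x + h *\<^sub>R (\<Sum>j\<in>UNIV. A $ i $ j *\<^sub>R K j)) (K i)
        + p (K i) (x + h *\<^sub>R (\<Sum>j\<in>UNIV. A $ i $ j *\<^sub>R K j))"
      using Y[of i] by (simp add: K_def)
    also have "\<dots> = p x (K i) + p (K i) x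
        + h *\<^sub>R (\<Sum>j\<in>UNIV. A $ i $ j *\<^sub>R (p (K i) (K j) + p (K j) (K i)))"
      by (simp add: expand scaleR_add_right sum.distrib)
    finally show ?thesis
      by (metis eq_neg_iff_add_eq_0)
  qed

  have linear_terms: "(\<Sum>i\<in>UNIV. b $ i *\<^sub>R (p x (K i) + p (K i) x))
      = - (h *\<^sub>R (\<Sum>i\<in>UNIV. \<Sum>j\<in>UNIV. (b $ i * b $ j) *\<^sub>R p (K i) (K j)))"
  proof -
    have "(\<Sum>i\<in>UNIV. b $ i *\<^sub>R (p x (K i) + p (K i) x))
        = - (h *\<^sub>R ((\<Sum>i\<in>UNIV. \<Sum>j\<in>UNIV. (b $ i * A $ i $ j) *\<^sub>R p (K i) (K j))
            + (\<Sum>i\<in>UNIV. \<Sum>j\<in>UNIV. (b $ i * A $ i $ j) *\<^sub>R p (K j) (K i))))"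
      by (simp add: stage scaleR_sum_right scaleR_add_right scaleR_diff_right sum.distrib
          sum_subtractf sum_negf mult_ac)
    also have "(\<Sum>i\<in>UNIV. \<Sum>j\<in>UNIV. (b $ i * A $ i $ j) *\<^sub>R p (K j) (K i))
        = (\<Sum>i\<in>UNIV. \<Sum>j\<in>UNIV. (b $ j * A $ j $ i) *\<^sub>R p (K i) (K j))"
      by (rule sum.swap)
    also have "(\<Sum>i\<in>UNIV. \<Sum>j\<in>UNIV. (b $ i * A $ i $ j) *\<^sub>R p (K i) (K j)) + \<dots>
        = (\<Sum>i\<in>UNIV. \<Sum>j\<in>UNIV. (b $ i * b $ j) *\<^sub>R p (K i) (K j))"
      by (simp add: symplectic_RK_entries[OF sympl] scaleR_add_left sum.distrib)
    finally show ?thesis .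
  qed

  have "p x' x' = p x x + h *\<^sub>R (\<Sum>i\<in>UNIV. b $ i *\<^sub>R (p x (K i) + p (K i) x))
      + h *\<^sub>R h *\<^sub>R (\<Sum>i\<in>UNIV. \<Sum>j\<in>UNIV. (b $ i * b $ j) *\<^sub>R p (K i) (K j))"
  proof -
    have "x' = x + h *\<^sub>R (\<Sum>i\<in>UNIV. b $ i *\<^sub>R K i)"
      by (simp add: x' K_def)
    moreover have "(\<Sum>j\<in>UNIV. (b $ j * h) *\<^sub>R (\<Sum>i\<in>UNIV. b $ i *\<^sub>R p (K i) (K j)))
        = h *\<^sub>R (\<Sum>i\<in>UNIV. \<Sum>j\<in>UNIV. (b $ i * b $ j) *\<^sub>R p (K i) (K j))"
      by (subst sum.swap) (simp add: scaleR_sum_right mult_ac)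
    ultimately show ?thesis
      by (simp add: expand scaleR_add_right sum.distrib)
  qed
  then show ?thesis
    by (simp add: linear_terms)
qed

lemma bilinear_transpose_mult:
  "bilinear (\<lambda>X Y :: real ^ 'm ^ 'n. transpose X ** Y)"
  by (auto simp: bilinear_def linear_iff vec_eq_iff matrix_matrix_mult_def transpose_def
      algebra_simps sum.distrib sum_distrib_left)

lemma skew_flow_preserves_transpose_mult:
  fixes S :: "real ^ 'n ^ 'n" and X :: "real ^ 'm ^ 'n"
  assumes "transpose S = - S"
  shows "transpose X ** (S ** X) + transpose (S ** X) ** X = 0"
proof -
  have "S ** X + transpose S ** X = (S + transpose S) ** X"
    by (simp add: vec_eq_iff matrix_matrix_mult_def distrib_right sum.distrib)
  also have "\<dots> = 0"
    by (simp add: assms)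
  finally have "transpose X ** (S ** X + transpose S ** X) = 0"
    by simp
  then show ?thesis
    by (simp add: matrix_transpose_mul matrix_mul_assoc matrix_add_ldistrib)
qed

theorem theorem3p2:
  fixes S :: "real ^ 'm ^ 'm"
    and Q :: "real \<Rightarrow> real ^ 'm ^ 'm" and T :: "real set" and t\<^sub>0 :: real
    and A :: "real ^ 's ^ 's" and b :: "real ^ 's"
    and \<Delta>t :: real and Qn :: "nat \<Rightarrow> real ^ 'm ^ 'm"
  assumes skew: "transpose S = - S"
    and interval: "is_interval T" "t\<^sub>0 \<in> T"
    and ode: "\<And>t. t \<in> T \<Longrightarrow> (Q has_vector_derivative S ** Q t) (at t within T)"
    and orth: "transpose (Q t\<^sub>0) ** Q t\<^sub>0 = mat 1"
    and sympl: "symplectic_RK A b"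
    and init: "Qn 0 = Q t\<^sub>0"
    and step: "\<And>k. RK_step A b (\<lambda>X. S ** X) \<Delta>t (Qn k) (Qn (Suc k))"
  shows "\<forall>k. transpose (Qn (Suc k)) ** Qn (Suc k) = transpose (Qn k) ** Qn k \<and>
             transpose (Qn k) ** Qn k = transpose (Q t\<^sub>0) ** Q t\<^sub>0 \<and>
             transpose (Q t\<^sub>0) ** Q t\<^sub>0 = mat 1 \<and>
             discrete_energy (Qn (Suc k)) = discrete_energy (Qn k)"
proof -
  have preserve: "transpose (Qn (Suc k)) ** Qn (Suc k) = transpose (Qn k) ** Qn k" for k
    by (rule symplectic_RK_preserves_quadratic_invariant[OF bilinear_transpose_mult
          skew_flow_preserves_transpose_mult[OF skew] sympl step])
  moreover have "transpose (Qn k) ** Qn k = transpose (Q t\<^sub>0) ** Q t\<^sub>0" for k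
    by (induction k) (simp_all add: init preserve)
  ultimately show ?thesis
    using orth by (simp add: discrete_energy_def)
qed

end
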